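(* Let $D\ge 2$ be an integer and let $\lambda_1,\dots,\lambda_D>0$ be real numbers with $\lambda_1+\dots+\lambda_D=1$. For $0<\epsilon<1$ let $$T_\epsilon=\left\{(x_1,\dots,x_D)\in\mathbb{R}^D \;\middle|\; \lambda_1^{x_1}\lambda_2^{x_2}\cdots\lambda_D^{x_D}\ge\epsilon,\ x_i\ge 0 \text{ for } 1\le i\le D\right\},$$ and, with sums over integer lattice points $\mathbf{m}=(m_1,\dots,m_D)\in\mathbb{Z}^D$ lying in $T_\epsilon$, let $$S(\epsilon)=\sum_{\mathbf{m}\in T_\epsilon}(m_1+\dots+m_D)\frac{(m_1+m_2+\dots+m_D)!}{m_1!\,m_2!\cdots m_D!},\qquad S^{\#}(\epsilon)=\sum_{\mathbf{m}\in T_\epsilon}\frac{(m_1+m_2+\dots+m_D)!}{m_1!\,m_2!\cdots m_D!}.$$ Then $$S(\epsilon)\asymp\frac{|\log\epsilon|}{\epsilon},\qquad S^{\#}(\epsilon)\asymp\frac{1}{\epsilon}$$ as $\epsilon$ tends to $0$.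
   Context: $f(\epsilon)\asymp g(\epsilon)$ as $\epsilon\to0$ means that there are constants $0<c\le C$ (here depending only on $D$ and $\lambda_1,\dots,\lambda_D$) and $\epsilon_0>0$ such that $c\,g(\epsilon)\le f(\epsilon)\le C\,g(\epsilon)$ for all $0<\epsilon<\epsilon_0$. *)

theory Defs
  imports "HOL-Analysis.Analysis"
begin

definition T_region :: "real ^ 'n::finite \<Rightarrow> real \<Rightarrow> (real ^ 'n) set" where
  "T_region lam \<epsilon> = {x. (\<Prod>i\<in>UNIV. (lam $ i) powr (x $ i)) \<ge> \<epsilon> \<and> (\<forall>i. x $ i \<ge> 0)}"

definition lattice_T :: "real ^ 'n::finite \<Rightarrow> real \<Rightarrow> (int ^ 'n) set" where
  "lattice_T lam \<epsilon> = {m. (\<chi> i. real_of_int (m $ i)) \<in> T_region lam \<epsilon>}"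

(* Only used for vectors with nonnegative entries, where the conversion nat loses nothing. *)
definition multinom :: "int ^ 'n::finite \<Rightarrow> real" where
  "multinom m = fact (nat (\<Sum>i\<in>UNIV. m $ i)) / (\<Prod>i\<in>UNIV. fact (nat (m $ i)))"

(* The index sets of the next two sums are finite if 0 < \<epsilon> and 0 < lam $ i < 1 for all i;
   see finite_lattice_T below. *)
definition S_sum :: "real ^ 'n::finite \<Rightarrow> real \<Rightarrow> real" where
  "S_sum lam \<epsilon> = (\<Sum>m\<in>lattice_T lam \<epsilon>. real_of_int (\<Sum>i\<in>UNIV. m $ i) * multinom m)"

definition S_sharp :: "real ^ 'n::finite \<Rightarrow> real \<Rightarrow> real" where
  "S_sharp lam \<epsilon> = (\<Sum>m\<in>lattice_T lam \<epsilon>. multinom m)"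

definition asymp_at_0 :: "(real \<Rightarrow> real) \<Rightarrow> (real \<Rightarrow> real) \<Rightarrow> bool" where
  "asymp_at_0 f g \<longleftrightarrow>
     (\<exists>c C \<epsilon>0. 0 < c \<and> c \<le> C \<and> 0 < \<epsilon>0 \<and>
        (\<forall>\<epsilon>. 0 < \<epsilon> \<and> \<epsilon> < \<epsilon>0 \<longrightarrow> c * g \<epsilon> \<le> f \<epsilon> \<and> f \<epsilon> \<le> C * g \<epsilon>))"

lemma finite_lattice_T:
  fixes lam :: "real ^ 'n::finite"
  assumes lam: "\<And>i. 0 < lam $ i" "\<And>i. lam $ i < 1" and \<epsilon>: "0 < \<epsilon>"
  shows "finite (lattice_T lam \<epsilon>)"
proof -
  define N where "N i = \<lfloor>ln \<epsilon> / ln (lam $ i)\<rfloor>" for i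
  have bnd: "0 \<le> m $ i \<and> m $ i \<le> N i" if "m \<in> lattice_T lam \<epsilon>" for m i
  proof -
    from that have nn: "\<And>j. 0 \<le> m $ j"
      and le: "\<epsilon> \<le> (\<Prod>j\<in>UNIV. (lam $ j) powr real_of_int (m $ j))"
      by (auto simp: lattice_T_def T_region_def)
    have p: "(lam $ j) powr real_of_int (m $ j) \<le> 1" for j
      using powr_mono'[of 0 "real_of_int (m $ j)" "lam $ j"] lam(1)[of j] lam(2)[of j] nn[of j] by simp
    have "(\<Prod>j\<in>UNIV. (lam $ j) powr real_of_int (m $ j))
        = (lam $ i) powr real_of_int (m $ i) * (\<Prod>j\<in>UNIV - {i}. (lam $ j) powr real_of_int (m $ j))"
      by (subst prod.remove[of _ i]) auto
    also have "\<dots> \<le> (lam $ i) powr real_of_int (m $ i) * 1"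
      by (intro mult_left_mono prod_le_1) (auto simp: p)
    finally have "\<epsilon> \<le> (lam $ i) powr real_of_int (m $ i)" using le by simp
    then have "ln \<epsilon> \<le> ln ((lam $ i) powr real_of_int (m $ i))"
      using \<epsilon> by (subst ln_le_cancel_iff) auto
    then have "ln \<epsilon> \<le> real_of_int (m $ i) * ln (lam $ i)"
      using lam(1)[of i] by (simp add: ln_powr)
    moreover have "ln (lam $ i) < 0" using lam by simp
    ultimately have "real_of_int (m $ i) \<le> ln \<epsilon> / ln (lam $ i)"
      by (simp add: neg_le_divide_eq)
    then show ?thesis using nn by (simp add: N_def le_floor_iff)
  qed
  have "vec_nth ` lattice_T lam \<epsilon> \<subseteq> (\<Pi>\<^sub>E i\<in>UNIV. {0..N i})"
    using bnd by auto
  then have "finite (vec_nth ` lattice_T lam \<epsilon>)"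
    by (rule finite_subset) (auto intro: finite_PiE)
  then show ?thesis
    by (rule finite_imageD) (auto simp: inj_on_def vec_nth_inject)
qed

end

theory Submission
  imports Defs
begin

text \<open>
  Read \<open>lam\<close> as a probability distribution on an alphabet of \<open>D = CARD('n)\<close> letters. The
  multinomial coefficient of \<open>m\<close> counts the words that contain the letter \<open>i\<close> exactly
  \<open>m $ i\<close> times, and each of them has probability \<open>lattice_weight lam m\<close>. So
  \<open>S_sharp lam \<epsilon>\<close> is the number of words of probability at least \<open>\<epsilon>\<close>, and \<open>S_sum lam \<epsilon>\<close>
  is the sum of their lengths. These words are the inner nodes of a \<open>D\<close>-ary tree: extending
  a word by a letter lowers its probability. The leaves just outside have total probability
  \<open>1\<close>, and with \<open>a\<close> the least entry of \<open>lam\<close> each of them has probability between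
  \<open>a * \<epsilon>\<close> and \<open>\<epsilon>\<close>; hence there are between \<open>1 / \<epsilon>\<close> and \<open>1 / (a * \<epsilon>)\<close> leaves. A \<open>D\<close>-ary
  tree with \<open>F\<close> inner nodes has \<open>(D - 1) * F + 1\<close> leaves, which gives the order \<open>1 / \<epsilon>\<close> of
  \<open>S_sharp\<close>.

  The proof carries this out without words. Sorting the words by their first letter becomes the
  recursion \<open>S_sharp lam \<epsilon> = 1 + (\<Sum>i\<in>UNIV. S_sharp lam (\<epsilon> / lam $ i))\<close> for \<open>\<epsilon> \<le> 1\<close>
  (\<open>S_sharp_recursion\<close>), which rests on Pascal's rule for multinomial coefficients. The leaf
  count then satisfies the same recursion without the summand \<open>1\<close>. This homogeneous recursion
  is also solved by \<open>c / \<epsilon>\<close> for every \<open>c\<close>, because the entries of \<open>lam\<close> sum to \<open>1\<close>, so the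
  bounds \<open>1 / \<epsilon>\<close> and \<open>1 / (a * \<epsilon>)\<close> propagate from large to small \<open>\<epsilon>\<close>
  (\<open>leaf_count_bounds\<close>).

  For \<open>S_sum\<close>, a word of probability at least \<open>\<epsilon>\<close> has length \<open>O(\<bar>ln \<epsilon>\<bar>)\<close>, which is the
  upper bound (\<open>S_sum_le\<close>). Conversely a word of probability less than \<open>sqrt \<epsilon>\<close> has length at
  least a constant times \<open>\<bar>ln \<epsilon>\<bar>\<close>, and all but \<open>O(1 / sqrt \<epsilon>)\<close> of the words counted by
  \<open>S_sharp lam \<epsilon>\<close> are of this kind, which is the lower bound (\<open>S_sum_ge\<close>).
\<close>

section \<open>Weights and degrees of lattice points\<close>

definition lattice_weight :: "real ^ 'n::finite \<Rightarrow> int ^ 'n \<Rightarrow> real" where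
  "lattice_weight lam m = (\<Prod>i\<in>UNIV. (lam $ i) powr real_of_int (m $ i))"

definition total_degree :: "int ^ 'n::finite \<Rightarrow> int" where
  "total_degree m = (\<Sum>i\<in>UNIV. m $ i)"

lemma mem_lattice_T:
  "m \<in> lattice_T lam \<epsilon> \<longleftrightarrow> \<epsilon> \<le> lattice_weight lam m \<and> (\<forall>i. 0 \<le> m $ i)"
  by (simp add: lattice_T_def T_region_def lattice_weight_def)

lemma axis_1_nth: "axis i (1 :: int) $ j = (if j = i then 1 else 0)"
  by (simp add: axis_def)

lemma total_degree_nonneg: "(\<And>i. 0 \<le> m $ i) \<Longrightarrow> 0 \<le> total_degree m"
  by (simp add: total_degree_def sum_nonneg)

lemma total_degree_pos:
  assumes "\<And>i. 0 \<le> m $ i" "m \<noteq> 0"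
  shows "0 < total_degree m"
proof -
  obtain j where "m $ j \<noteq> 0" using assms(2) by (auto simp: vec_eq_iff)
  with assms(1)[of j] have "0 < m $ j" by simp
  then show ?thesis
    unfolding total_degree_def using assms(1) by (intro sum_pos2[of _ j]) auto
qed

lemma total_degree_add_axis: "total_degree (m + axis i 1) = total_degree m + 1"
  by (simp add: total_degree_def sum.distrib axis_1_nth)

lemma lattice_weight_0: "(\<And>i. 0 < lam $ i) \<Longrightarrow> lattice_weight lam 0 = 1"
  by (simp add: lattice_weight_def less_le)

lemma lattice_weight_add_axis:
  assumes "\<And>i. 0 < lam $ i"
  shows "lattice_weight lam (m + axis i 1) = lam $ i * lattice_weight lam m"
proof -
  have "lattice_weight lam (m + axis i 1)
      = (\<Prod>j\<in>UNIV. lam $ j powr real_of_int (m $ j) * (if j = i then lam $ j else 1))"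
    unfolding lattice_weight_def
    by (intro prod.cong) (auto simp: axis_1_nth powr_add assms less_imp_le)
  then show ?thesis
    by (simp add: prod.distrib lattice_weight_def)
qed

lemma powr_total_degree:
  "0 < (c::real) \<Longrightarrow> c powr real_of_int (total_degree m) = (\<Prod>i\<in>UNIV. c powr real_of_int (m $ i))"
  by (simp add: total_degree_def powr_sum)

lemma lattice_weight_le:
  assumes "\<And>i. 0 < lam $ i" "\<And>i. lam $ i \<le> b" "0 < b" "\<And>i. 0 \<le> m $ i"
  shows "lattice_weight lam m \<le> b powr real_of_int (total_degree m)"
  unfolding lattice_weight_def powr_total_degree[OF assms(3)]
  using assms by (intro prod_mono) (auto intro!: powr_mono2 simp: less_imp_le)

lemma lattice_weight_ge:
  assumes "\<And>i. a \<le> lam $ i" "0 < a" "\<And>i. 0 \<le> m $ i"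
  shows "a powr real_of_int (total_degree m) \<le> lattice_weight lam m"
  unfolding lattice_weight_def powr_total_degree[OF assms(2)]
  using assms by (intro prod_mono) (auto intro!: powr_mono2 simp: less_imp_le)

lemma multinom_nonneg: "0 \<le> multinom m"
  by (simp add: multinom_def prod_nonneg)

text \<open>
  This is Pascal's rule in a form that can be reindexed: dividing by the total degree, the
  share \<open>m $ i / total_degree m\<close> of the coefficient at \<open>m\<close> equals the coefficient at
  \<open>m - axis i 1\<close>. In terms of words, it is the number of words whose first letter is \<open>i\<close>.
\<close>

lemma multinom_add_axis:
  assumes "\<And>j. 0 \<le> m $ j"
  shows "real_of_int ((m + axis i 1) $ i) * multinom (m + axis i 1)
       = real_of_int (total_degree (m + axis i 1)) * multinom m"
proof -
  define P where "P = (\<Prod>j\<in>UNIV. fact (nat (m $ j)) :: real)"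
  have P0: "P \<noteq> 0" by (simp add: P_def)
  have i0: "real_of_int (m $ i) + 1 \<noteq> 0" using assms[of i] by linarith
  have "(\<Prod>j\<in>UNIV. fact (nat ((m + axis i 1) $ j)) :: real)
      = (\<Prod>j\<in>UNIV. fact (nat (m $ j)) * (if j = i then real_of_int (m $ j) + 1 else 1))"
    using assms by (intro prod.cong) (auto simp: axis_1_nth nat_add_distrib)
  then have prod_eq: "(\<Prod>j\<in>UNIV. fact (nat ((m + axis i 1) $ j)) :: real) = P * (real_of_int (m $ i) + 1)"
    by (simp add: prod.distrib P_def)
  have "(fact (nat (total_degree (m + axis i 1))) :: real)
      = (real_of_int (total_degree m) + 1) * fact (nat (total_degree m))"
    using total_degree_nonneg[of m] assms by (simp add: total_degree_add_axis nat_add_distrib)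
  then show ?thesis
    unfolding multinom_def total_degree_def[symmetric] prod_eq P_def[symmetric]
    using P0 i0 by (simp add: total_degree_add_axis axis_1_nth)
qed

section \<open>The order of the number of words\<close>

lemma S_sharp_eq_0:
  assumes lam: "\<And>i. 0 < lam $ i" "\<And>i. lam $ i < 1" and "1 < \<epsilon>"
  shows "S_sharp lam \<epsilon> = 0"
proof -
  have "m \<notin> lattice_T lam \<epsilon>" for m
    using lattice_weight_le[of lam 1 m] lam \<open>1 < \<epsilon>\<close>
    by (fastforce simp: mem_lattice_T less_imp_le)
  then have "lattice_T lam \<epsilon> = {}" by blast
  then show ?thesis by (simp add: S_sharp_def)
qed

text \<open>
  Removing one occurrence of the letter \<open>i\<close> divides the weight by \<open>lam $ i\<close>, so it relaxes the
  threshold \<open>\<epsilon>\<close> to \<open>\<epsilon> / lam $ i\<close>.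
\<close>

lemma lattice_T_shift:
  assumes lam: "\<And>i. 0 < lam $ i"
  shows "bij_betw (\<lambda>m. m + axis i 1) (lattice_T lam (\<epsilon> / lam $ i))
           {m \<in> lattice_T lam \<epsilon>. 0 < m $ i}"
proof (rule bij_betw_byWitness[where f' = "\<lambda>m. m - axis i 1"])
  have *: "\<epsilon> / lam $ i \<le> w \<longleftrightarrow> \<epsilon> \<le> lam $ i * w" for w
    using lam[of i] by (simp add: pos_divide_le_eq mult.commute)
  show "(\<lambda>m. m + axis i 1) ` lattice_T lam (\<epsilon> / lam $ i) \<subseteq> {m \<in> lattice_T lam \<epsilon>. 0 < m $ i}"
    by (auto simp: mem_lattice_T lattice_weight_add_axis[OF lam] * axis_1_nth add_nonneg_pos)
  show "(\<lambda>m. m - axis i 1) ` {m \<in> lattice_T lam \<epsilon>. 0 < m $ i} \<subseteq> lattice_T lam (\<epsilon> / lam $ i)"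
  proof clarify
    fix m assume m: "m \<in> lattice_T lam \<epsilon>" "0 < m $ i"
    have "lattice_weight lam m = lam $ i * lattice_weight lam (m - axis i 1)"
      using lattice_weight_add_axis[OF lam, of "m - axis i 1" i] by simp
    with m show "m - axis i 1 \<in> lattice_T lam (\<epsilon> / lam $ i)"
      by (simp add: mem_lattice_T * axis_1_nth)
  qed
qed auto

text \<open>
  The summand \<open>1\<close> is the empty word. Every other multinomial coefficient splits into its
  shares for the possible first letters, and the shares for the letter \<open>i\<close> add up to the sum
  over the region with threshold \<open>\<epsilon> / lam $ i\<close>.
\<close>

lemma S_sharp_recursion:
  fixes lam :: "real ^ 'n::finite"
  assumes lam: "\<And>i. 0 < lam $ i" "\<And>i. lam $ i < 1" and \<epsilon>: "0 < \<epsilon>" "\<epsilon> \<le> 1"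
  shows "S_sharp lam \<epsilon> = 1 + (\<Sum>i\<in>UNIV. S_sharp lam (\<epsilon> / lam $ i))"
proof -
  let ?T = "lattice_T lam \<epsilon>"
  define r where "r i m = real_of_int (m $ i) / real_of_int (total_degree m) * multinom m" for i and m :: "int ^ 'n"
  have fin: "finite ?T" using finite_lattice_T lam \<epsilon>(1) by blast
  have zero: "0 \<in> ?T" using lattice_weight_0[of lam] lam \<epsilon> by (simp add: mem_lattice_T)
  \<comment> \<open>\<open>r i m\<close> counts the words with content \<open>m\<close> whose first letter is \<open>i\<close>.\<close>
  have split: "multinom m = (\<Sum>i\<in>UNIV. r i m)" if "m \<in> ?T - {0}" for m
  proof -
    have "0 < total_degree m" using that total_degree_pos[of m] by (auto simp: mem_lattice_T)
    moreover have "(\<Sum>i\<in>UNIV. r i m) = (\<Sum>i\<in>UNIV. real_of_int (m $ i)) * (multinom m / real_of_int (total_degree m))"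
      by (simp add: r_def sum_distrib_right sum_divide_distrib)
    moreover have "(\<Sum>i\<in>UNIV. real_of_int (m $ i)) = real_of_int (total_degree m)"
      by (simp add: total_degree_def)
    ultimately show ?thesis by simp
  qed
  have shift: "(\<Sum>m\<in>?T - {0}. r i m) = S_sharp lam (\<epsilon> / lam $ i)" for i
  proof -
    have "(\<Sum>m\<in>?T - {0}. r i m) = (\<Sum>m\<in>{m \<in> ?T. 0 < m $ i}. r i m)"
      by (rule sum.mono_neutral_right)
        (use fin in \<open>auto simp: r_def mem_lattice_T order.order_iff_strict\<close>)
    also have "\<dots> = (\<Sum>m\<in>lattice_T lam (\<epsilon> / lam $ i). r i (m + axis i 1))"
      by (rule sum.reindex_bij_betw[OF lattice_T_shift[OF lam(1)], symmetric])
    also have "\<dots> = (\<Sum>m\<in>lattice_T lam (\<epsilon> / lam $ i). multinom m)"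
    proof (rule sum.cong)
      fix m assume "m \<in> lattice_T lam (\<epsilon> / lam $ i)"
      then have nn: "\<And>j. 0 \<le> m $ j" by (simp add: mem_lattice_T)
      have "real_of_int (total_degree (m + axis i 1)) \<noteq> 0"
        using total_degree_nonneg[OF nn] unfolding total_degree_add_axis by linarith
      then show "r i (m + axis i 1) = multinom m"
        using multinom_add_axis[OF nn, of i] by (simp add: r_def)
    qed simp
    finally show ?thesis by (simp add: S_sharp_def)
  qed
  have "S_sharp lam \<epsilon> = multinom (0 :: int ^ 'n) + (\<Sum>m\<in>?T - {0}. multinom m)"
    unfolding S_sharp_def by (rule sum.remove[OF fin zero])
  also have "(\<Sum>m\<in>?T - {0}. multinom m) = (\<Sum>m\<in>?T - {0}. \<Sum>i\<in>UNIV. r i m)"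
    by (rule sum.cong[OF refl split])
  also have "\<dots> = (\<Sum>i\<in>UNIV. S_sharp lam (\<epsilon> / lam $ i))"
    by (subst sum.swap) (simp add: shift)
  finally show ?thesis by (simp add: multinom_def)
qed

text \<open>
  Here \<open>G \<epsilon>\<close> is the number of leaves of the tree of words of probability at least \<open>\<epsilon>\<close>. In the
  recursion for \<open>G\<close> the constants cancel, since \<open>(D - 1) + 1 = D\<close>. For \<open>1 < \<epsilon> \<le> 1 / a\<close> the tree
  is a single leaf and both bounds are clear. For \<open>\<epsilon> \<le> 1\<close> all arguments \<open>\<epsilon> / lam $ i\<close> are
  still at most \<open>1 / a\<close>, and they are larger than \<open>\<epsilon>\<close> by at least the factor \<open>1 / b\<close>; so the
  bounds are proved for \<open>b ^ n < \<epsilon>\<close> by induction on \<open>n\<close>. Summing the bounds at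
  \<open>\<epsilon> / lam $ i\<close> over \<open>i\<close> gives exactly the bounds at \<open>\<epsilon>\<close>.
\<close>

lemma leaf_count_bounds:
  fixes lam :: "real ^ 'n::finite"
  assumes lam: "\<And>i. a \<le> lam $ i" "\<And>i. lam $ i \<le> b" "(\<Sum>i\<in>UNIV. lam $ i) = 1"
    and a: "0 < a" and b: "b < 1" and \<epsilon>: "0 < \<epsilon>" "\<epsilon> \<le> 1 / a"
  defines "G \<equiv> \<lambda>x. (real CARD('n) - 1) * S_sharp lam x + 1"
  shows "1 / \<epsilon> \<le> G \<epsilon> \<and> G \<epsilon> \<le> 1 / (a * \<epsilon>)"
proof -
  have pos: "0 < lam $ i" and lt1: "lam $ i < 1" for i
    using lam(1)[of i] lam(2)[of i] a b by linarith+
  have b0: "0 < b" using pos lam(2) by (meson less_le_trans)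
  have rec: "G x = (\<Sum>i\<in>UNIV. G (x / lam $ i))" if "0 < x" "x \<le> 1" for x
    using S_sharp_recursion[OF pos lt1 that]
    by (simp add: G_def sum.distrib flip: sum_distrib_left) (simp add: algebra_simps)
  have "1 / x \<le> G x \<and> G x \<le> 1 / (a * x)" if "b ^ n < x" "x \<le> 1 / a" for n x
    using that
  proof (induction n arbitrary: x)
    case 0
    then have "1 < x" by simp
    then show ?case
      using S_sharp_eq_0[OF pos lt1] 0 a by (simp add: G_def field_simps)
  next
    case (Suc n)
    have x0: "0 < x" using Suc.prems(1) b0 by (meson less_trans zero_less_power)
    show ?case
    proof (cases "x \<le> 1")
      case False
      then show ?thesis
        using S_sharp_eq_0[OF pos lt1] Suc.prems(2) a by (simp add: G_def field_simps)
    next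
      case True
      have IH: "1 / (x / lam $ i) \<le> G (x / lam $ i) \<and> G (x / lam $ i) \<le> 1 / (a * (x / lam $ i))" for i
      proof (rule Suc.IH)
        have "b ^ n * lam $ i \<le> b ^ n * b" using lam(2) b0 by (intro mult_left_mono) auto
        then show "b ^ n < x / lam $ i" using Suc.prems(1) pos by (simp add: pos_less_divide_eq mult.commute)
        show "x / lam $ i \<le> 1 / a" using True lam(1)[of i] a x0 by (intro frac_le) auto
      qed
      have "1 / x = (\<Sum>i\<in>UNIV. 1 / (x / lam $ i))"
        using lam(3) by (simp flip: sum_divide_distrib)
      also have "\<dots> \<le> G x" unfolding rec[OF x0 True] by (intro sum_mono) (use IH in blast)
      finally have lower: "1 / x \<le> G x" .
      have "G x \<le> (\<Sum>i\<in>UNIV. 1 / (a * (x / lam $ i)))"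
        unfolding rec[OF x0 True] by (intro sum_mono) (use IH in blast)
      also have "\<dots> = 1 / (a * x)"
        using lam(3) by (simp flip: sum_divide_distrib)
      finally show ?thesis using lower by blast
    qed
  qed
  moreover obtain n where "b ^ n < \<epsilon>" using real_arch_pow_inv[OF \<epsilon>(1) b] by blast
  ultimately show ?thesis using \<epsilon>(2) by blast
qed

section \<open>Comparing total length and number of words\<close>

lemma asymp_at_0I:
  assumes "0 < c" "0 < \<epsilon>0" "\<And>\<epsilon>. 0 < \<epsilon> \<Longrightarrow> \<epsilon> < \<epsilon>0 \<Longrightarrow> 0 \<le> g \<epsilon>"
    and "\<And>\<epsilon>. 0 < \<epsilon> \<Longrightarrow> \<epsilon> < \<epsilon>0 \<Longrightarrow> c * g \<epsilon> \<le> f \<epsilon>"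
    and "\<And>\<epsilon>. 0 < \<epsilon> \<Longrightarrow> \<epsilon> < \<epsilon>0 \<Longrightarrow> f \<epsilon> \<le> C * g \<epsilon>"
  shows "asymp_at_0 f g"
  unfolding asymp_at_0_def
proof (rule exI[of _ c], rule exI[of _ "max c C"], rule exI[of _ \<epsilon>0], intro conjI allI impI)
  fix \<epsilon> assume e: "0 < \<epsilon> \<and> \<epsilon> < \<epsilon>0"
  then have "C * g \<epsilon> \<le> max c C * g \<epsilon>" using assms(3) by (intro mult_right_mono) auto
  then show "f \<epsilon> \<le> max c C * g \<epsilon>" using assms(5)[of \<epsilon>] e by linarith
qed (use assms in auto)

text \<open>
  If every letter has probability at most \<open>b\<close>, a word of length \<open>k\<close> has probability at most
  \<open>b ^ k\<close>; so probability at least \<open>\<epsilon>\<close> forces \<open>k \<le> \<bar>ln \<epsilon>\<bar> / \<bar>ln b\<bar>\<close>.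
\<close>

lemma S_sum_le:
  assumes lam: "\<And>i. 0 < lam $ i" "\<And>i. lam $ i \<le> b" and b: "0 < b" "b < 1" and \<epsilon>: "0 < \<epsilon>" "\<epsilon> \<le> 1"
  shows "S_sum lam \<epsilon> \<le> \<bar>ln \<epsilon>\<bar> / \<bar>ln b\<bar> * S_sharp lam \<epsilon>"
  unfolding S_sum_def S_sharp_def sum_distrib_left total_degree_def[symmetric]
proof (intro sum_mono mult_right_mono multinom_nonneg)
  fix m assume "m \<in> lattice_T lam \<epsilon>"
  then have "\<epsilon> \<le> b powr real_of_int (total_degree m)"
    using lattice_weight_le[of lam b m] lam b by (force simp: mem_lattice_T)
  then have "ln \<epsilon> \<le> real_of_int (total_degree m) * ln b"
    using \<epsilon> b ln_le_cancel_iff[of \<epsilon> "b powr real_of_int (total_degree m)"] by simp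
  then show "real_of_int (total_degree m) \<le> \<bar>ln \<epsilon>\<bar> / \<bar>ln b\<bar>"
    using \<epsilon> b by (simp add: neg_le_divide_eq)
qed

text \<open>
  If every letter has probability at least \<open>a\<close>, a word of length \<open>k\<close> has probability at least
  \<open>a ^ k\<close>; so the words of probability in the range from \<open>\<epsilon>\<close> to below \<open>\<delta>\<close> all have length
  greater than \<open>\<bar>ln \<delta>\<bar> / \<bar>ln a\<bar>\<close>. The other words contribute a nonnegative amount.
\<close>

lemma S_sum_ge:
  assumes lam: "\<And>i. a \<le> lam $ i" "\<And>i. lam $ i < 1" and a: "0 < a" "a < 1"
    and \<epsilon>: "0 < \<epsilon>" "\<epsilon> \<le> \<delta>" "\<delta> \<le> 1"
  shows "\<bar>ln \<delta>\<bar> / \<bar>ln a\<bar> * (S_sharp lam \<epsilon> - S_sharp lam \<delta>) \<le> S_sum lam \<epsilon>"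
proof -
  have pos: "0 < lam $ i" for i using lam(1)[of i] a by linarith
  have fin: "finite (lattice_T lam \<epsilon>)" using finite_lattice_T pos lam(2) \<epsilon>(1) by blast
  have sub: "lattice_T lam \<delta> \<subseteq> lattice_T lam \<epsilon>" using \<epsilon> by (auto simp: mem_lattice_T)
  have "S_sharp lam \<epsilon> - S_sharp lam \<delta> = (\<Sum>m\<in>lattice_T lam \<epsilon> - lattice_T lam \<delta>. multinom m)"
    unfolding S_sharp_def by (rule sum_diff[OF fin sub, symmetric])
  then have "\<bar>ln \<delta>\<bar> / \<bar>ln a\<bar> * (S_sharp lam \<epsilon> - S_sharp lam \<delta>)
      = (\<Sum>m\<in>lattice_T lam \<epsilon> - lattice_T lam \<delta>. \<bar>ln \<delta>\<bar> / \<bar>ln a\<bar> * multinom m)"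
    by (simp add: sum_distrib_left)
  also have "\<dots> \<le> (\<Sum>m\<in>lattice_T lam \<epsilon> - lattice_T lam \<delta>. real_of_int (total_degree m) * multinom m)"
  proof (intro sum_mono mult_right_mono multinom_nonneg)
    fix m assume "m \<in> lattice_T lam \<epsilon> - lattice_T lam \<delta>"
    then have "a powr real_of_int (total_degree m) < \<delta>"
      using lattice_weight_ge[of a lam m] lam a by (force simp: mem_lattice_T)
    then have "real_of_int (total_degree m) * ln a < ln \<delta>"
      using \<epsilon> a ln_less_cancel_iff[of "a powr real_of_int (total_degree m)" \<delta>] by simp
    then show "\<bar>ln \<delta>\<bar> / \<bar>ln a\<bar> \<le> real_of_int (total_degree m)"
      using \<epsilon> a by (simp add: neg_divide_le_eq)
  qed
  also have "\<dots> \<le> (\<Sum>m\<in>lattice_T lam \<epsilon>. real_of_int (total_degree m) * multinom m)"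
    by (rule sum_mono2[OF fin])
      (auto simp: mem_lattice_T multinom_nonneg total_degree_nonneg intro!: mult_nonneg_nonneg)
  finally show ?thesis by (simp add: S_sum_def total_degree_def)
qed

theorem theorem1p5:
  fixes lam :: "real ^ 'n::finite"
  assumes "CARD('n) \<ge> 2"
    and "\<And>i. lam $ i > 0"
    and "(\<Sum>i\<in>UNIV. lam $ i) = 1"
  shows "asymp_at_0 (S_sum lam) (\<lambda>\<epsilon>. \<bar>ln \<epsilon>\<bar> / \<epsilon>) \<and>
         asymp_at_0 (S_sharp lam) (\<lambda>\<epsilon>. 1 / \<epsilon>)"
proof -
  define a where "a = Min (range (\<lambda>i. lam $ i))"
  define b where "b = Max (range (\<lambda>i. lam $ i))"
  define d where "d = real CARD('n) - 1"
  have lt1: "lam $ i < 1" for i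
  proof -
    have "UNIV - {i} \<noteq> {}"
    proof
      assume "UNIV - {i} = {}"
      then have "(UNIV :: 'n set) = {i}" by blast
      then have "CARD('n) = 1" by (metis card_1_singleton_iff One_nat_def)
      with assms(1) show False by simp
    qed
    then have "0 < (\<Sum>j\<in>UNIV - {i}. lam $ j)" using assms(2) by (intro sum_pos) auto
    then show ?thesis using assms(3) sum.remove[of UNIV i "\<lambda>j. lam $ j"] by simp
  qed
  have a_le: "a \<le> lam $ i" and b_ge: "lam $ i \<le> b" for i
    by (simp_all add: a_def b_def)
  have a0: "0 < a" and b1: "b < 1"
    using assms(2) lt1 by (simp_all add: a_def b_def)
  have a1: "a < 1" and b0: "0 < b"
    using a_le b_ge a0 b1 by (meson le_less_trans less_le_trans)+
  have d1: "1 \<le> d" using assms(1) by (simp add: d_def)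
  have bounds: "(1 / \<epsilon> - 1) / d \<le> S_sharp lam \<epsilon> \<and> S_sharp lam \<epsilon> \<le> 1 / (a * d) * (1 / \<epsilon>)"
    if "0 < \<epsilon>" "\<epsilon> \<le> 1" for \<epsilon>
  proof -
    have "\<epsilon> \<le> 1 / a" using that a0 a1 by (simp add: pos_le_divide_eq mult_le_one)
    from leaf_count_bounds[OF a_le b_ge assms(3) a0 b1 that(1) this]
    have "1 / \<epsilon> - 1 \<le> d * S_sharp lam \<epsilon>" "d * S_sharp lam \<epsilon> \<le> 1 / (a * \<epsilon>)"
      by (auto simp: d_def)
    moreover from this have "S_sharp lam \<epsilon> \<le> 1 / (a * \<epsilon>) / d"
      using d1 by (subst pos_le_divide_eq) (simp_all add: mult.commute)
    moreover from calculation have "(1 / \<epsilon> - 1) / d \<le> S_sharp lam \<epsilon>"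
      using d1 by (subst pos_divide_le_eq) (simp_all add: mult.commute)
    ultimately show ?thesis by (simp add: mult_ac)
  qed
  have half: "1 / (2 * d) * (1 / \<epsilon>) \<le> S_sharp lam \<epsilon>" if "0 < \<epsilon>" "\<epsilon> \<le> 1 / 2" for \<epsilon>
  proof -
    have "1 / (2 * \<epsilon>) \<le> 1 / \<epsilon> - 1" using that by (simp add: field_simps)
    then have "1 / (2 * \<epsilon>) / d \<le> (1 / \<epsilon> - 1) / d" using d1 by (intro divide_right_mono) auto
    then show ?thesis using bounds[of \<epsilon>] that by (simp add: mult.commute mult.left_commute)
  qed
  have sharp: "asymp_at_0 (S_sharp lam) (\<lambda>\<epsilon>. 1 / \<epsilon>)"
    by (rule asymp_at_0I[of "1 / (2 * d)" "1 / 2" _ _ "1 / (a * d)"])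
      (use d1 half bounds in auto)
  \<comment> \<open>This threshold makes \<open>sqrt \<epsilon> \<le> a / 4\<close>, so that the upper bound \<open>1 / (a * d * sqrt \<epsilon>)\<close> on
    \<open>S_sharp lam (sqrt \<epsilon>)\<close> is at most half of the lower bound \<open>1 / (2 * d * \<epsilon>)\<close> on
    \<open>S_sharp lam \<epsilon>\<close>.\<close>
  define \<epsilon>0 where "\<epsilon>0 = (a / 4)\<^sup>2"
  have \<epsilon>0: "0 < \<epsilon>0" "\<epsilon>0 \<le> 1 / 2"
    using a0 a1 power_mono[of "a / 4" "1 / 4" 2] by (auto simp: \<epsilon>0_def power2_eq_square)
  have "asymp_at_0 (S_sum lam) (\<lambda>\<epsilon>. \<bar>ln \<epsilon>\<bar> / \<epsilon>)"
  proof (rule asymp_at_0I[of "1 / (8 * d * \<bar>ln a\<bar>)" \<epsilon>0 _ _ "1 / (a * d * \<bar>ln b\<bar>)"])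
    show "0 < 1 / (8 * d * \<bar>ln a\<bar>)" using d1 a0 a1 by (simp add: mult_pos_neg)
    fix \<epsilon> :: real assume e: "0 < \<epsilon>" "\<epsilon> < \<epsilon>0"
    then have e1: "\<epsilon> \<le> 1 / 2" "\<epsilon> \<le> 1" using \<epsilon>0 by auto
    show "0 \<le> \<bar>ln \<epsilon>\<bar> / \<epsilon>" using e by simp
    have "S_sum lam \<epsilon> \<le> \<bar>ln \<epsilon>\<bar> / \<bar>ln b\<bar> * S_sharp lam \<epsilon>"
      using S_sum_le[OF assms(2) b_ge b0 b1 e(1) e1(2)] .
    also have "\<dots> \<le> \<bar>ln \<epsilon>\<bar> / \<bar>ln b\<bar> * (1 / (a * d) * (1 / \<epsilon>))"
      using bounds[OF e(1) e1(2)] by (intro mult_left_mono) auto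
    finally show "S_sum lam \<epsilon> \<le> 1 / (a * d * \<bar>ln b\<bar>) * (\<bar>ln \<epsilon>\<bar> / \<epsilon>)"
      by (simp add: mult_ac)
    define s where "s = sqrt \<epsilon>"
    have s: "0 < s" "s \<le> 1" "\<epsilon> = s * s" using e(1) e1(2) by (auto simp: s_def)
    have s_le: "s \<le> a / 4"
      unfolding s_def using e a0 by (intro real_le_lsqrt) (auto simp: \<epsilon>0_def)
    have "\<epsilon> \<le> s" using s mult_left_le[of s s] by simp
    have "S_sharp lam s \<le> 1 / (a * d) * (1 / s)" using bounds s by blast
    also have "\<dots> \<le> 1 / (4 * d) * (1 / \<epsilon>)"
      using s_le s a0 d1 by (simp add: field_simps)
    finally have diff: "1 / (4 * d) * (1 / \<epsilon>) \<le> S_sharp lam \<epsilon> - S_sharp lam s"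
      using half[OF e(1) e1(1)] by simp
    have ln_s: "\<bar>ln s\<bar> = \<bar>ln \<epsilon>\<bar> / 2" using e(1) by (simp add: s_def ln_sqrt)
    have "1 / (8 * d * \<bar>ln a\<bar>) * (\<bar>ln \<epsilon>\<bar> / \<epsilon>) = \<bar>ln s\<bar> / \<bar>ln a\<bar> * (1 / (4 * d) * (1 / \<epsilon>))"
      unfolding ln_s by simp
    also have "\<dots> \<le> \<bar>ln s\<bar> / \<bar>ln a\<bar> * (S_sharp lam \<epsilon> - S_sharp lam s)"
      using diff by (intro mult_left_mono) auto
    also have "\<dots> \<le> S_sum lam \<epsilon>"
      by (rule S_sum_ge[OF a_le lt1 a0 a1 e(1) \<open>\<epsilon> \<le> s\<close> s(2)])
    finally show "1 / (8 * d * \<bar>ln a\<bar>) * (\<bar>ln \<epsilon>\<bar> / \<epsilon>) \<le> S_sum lam \<epsilon>" .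
  qed (use \<epsilon>0 in auto)
  with sharp show ?thesis by blast
qed

end
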